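(* Let $F$ be a simple graph of order $n\ge 1$, let $V_k=\{v_1,\ldots,v_k\}\subseteq V(F)$ with $|V_k|=k$, and let $H_v$ be a simple graph of order $m\ge 2$ with a specified vertex $v$ of degree $m-1$. Put $H_1=H_v-v$ and $G=G[F,V_k,H_v]$. Order the vertices of $F$ so that $v_1,\ldots,v_k$ come first. Then the characteristic polynomial of the adjacency matrix of $G$ is $$f_{A(G)}(x)=\bigl(f_{A(H_1)}(x)\bigr)^k\det(xI_n-M),\qquad M=A(F)+\Gamma_{A(H_1)}(x)\begin{pmatrix} I_k & 0\\ 0&0\end{pmatrix},$$ where the block matrix is $n\times n$.
   Context: All graphs are finite and simple. For a square matrix $N$ of order $s$, $f_N(x)=\det(xI_s-N)$ is its characteristic polynomial, and its coronal is $\Gamma_N(x)=\mathbf 1_s^T(xI_s-N)^{-1}\mathbf 1_s$, a rational function of $x$, where $\mathbf 1_s$ is the all-ones column vector; the identity is an identity of rational functions in $x$. $A(\cdot)$ denotes the adjacency matrix. Graph with $k$ pockets: $G[F,V_k,H_v]$ is obtained by taking one copy of $F$ and $k$ vertex-disjoint copies of $H_v$, and, for each $i=1,\ldots,k$, identifying the vertex $v$ of the $i$th copy of $H_v$ with the vertex $v_i$ of $F$. *)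

theory Defs
  imports
    "Graph_Theory.Pair_Digraph"
    "Jordan_Normal_Form.Gauss_Jordan_Elimination"
    "Jordan_Normal_Form.Char_Poly"
    "HOL-Computational_Algebra.Polynomial_Factorial"
begin

text \<open>
  Finite simple graphs are the symmetric, loop-free, finite digraphs without parallel arcs of the
  locale \<^locale>\<open>graph\<close>; the degree of a vertex is then its out-degree. The list \<open>us\<close> is the
  ordering of the vertices that indexes the rows and columns.
\<close>

definition adjacency_mat :: "('a, 'e) pre_digraph \<Rightarrow> 'a list \<Rightarrow> 'c::{zero,one} mat" where
  "adjacency_mat G us =
     mat (length us) (length us) (\<lambda>(i, j). if us ! i \<rightarrow>\<^bsub>G\<^esub> us ! j then 1 else 0)"


text \<open>
  Rational functions over a field \<open>'a\<close> are the elements of \<open>'a poly fract\<close>.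
\<close>

definition ratfun_x :: "'a::field poly fract" where
  "ratfun_x = to_fract [:0, 1:]"

definition ratfun_mat :: "'a::field mat \<Rightarrow> 'a poly fract mat" where
  "ratfun_mat N = map_mat (\<lambda>a. to_fract [:a:]) N"

definition coronal :: "'a::field mat \<Rightarrow> 'a poly fract" where
  "coronal N =
     (let s = dim_row N; one = vec s (\<lambda>_. 1)
      in one \<bullet> (the (mat_inverse (ratfun_x \<cdot>\<^sub>m 1\<^sub>m s - ratfun_mat N)) *\<^sub>v one))"

lemma det_ratfun_mat:
  fixes N :: "'a::field mat"
  assumes N: "N \<in> carrier_mat s s"
  shows "det (ratfun_x \<cdot>\<^sub>m 1\<^sub>m s - ratfun_mat N) = to_fract (char_poly N)"
proof -
  interpret h: comm_ring_hom "to_fract :: 'a poly \<Rightarrow> 'a poly fract"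
    by unfold_locales auto
  have const: "to_fract [:- a:] = - to_fract [:a:]" for a :: 'a
    using to_fract_uminus[of "[:a:]"] by simp
  have lin: "to_fract (pCons (- a) 1) = to_fract [:0, 1:] - to_fract [:a:]" for a :: 'a
    using to_fract_diff[of "[:0, 1:]" "[:a:]"] by (simp add: one_pCons)
  have "ratfun_x \<cdot>\<^sub>m 1\<^sub>m s - ratfun_mat N = map_mat to_fract (char_poly_matrix N)"
    using N by (intro eq_matI)
      (auto simp: ratfun_x_def ratfun_mat_def char_poly_matrix_def const lin)
  then show ?thesis
    by (simp add: char_poly_def)
qed

text \<open>
  The matrix inverted in \<^const>\<open>coronal\<close> is invertible for every square \<open>N\<close>, so \<^const>\<open>the\<close> is
  harmless there.
\<close>

lemma mat_inverse_ratfun_mat: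
  fixes N :: "'a::field mat"
  assumes N: "N \<in> carrier_mat s s"
  defines "B \<equiv> ratfun_x \<cdot>\<^sub>m 1\<^sub>m s - ratfun_mat N"
  shows "\<exists>C. mat_inverse B = Some C \<and> C \<in> carrier_mat s s \<and> B * C = 1\<^sub>m s \<and> C * B = 1\<^sub>m s"
proof -
  have B: "B \<in> carrier_mat s s"
    using N by (auto simp: B_def ratfun_mat_def)
  have "char_poly N \<noteq> 0"
    using degree_monic_char_poly[OF N] by auto
  then have "det B \<noteq> 0"
    using det_ratfun_mat[OF N] by (simp add: B_def)
  then have "B \<in> Units (ring_mat TYPE('a poly fract) s ())"
    by (rule det_non_zero_imp_unit[OF B])
  then show ?thesis
    using mat_inverse(1)[OF B, where b = "()"] mat_inverse(2)[OF B] by (cases "mat_inverse B") auto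
qed


text \<open>
  The graph with pockets. The list \<open>us\<close> is \<open>v\<^sub>1, \<dots>, v\<^sub>k\<close>, indexed from \<open>0\<close>. The vertices of \<open>F\<close>
  become \<open>Inl u\<close>, and \<open>pocket_map us v i\<close> is the inclusion of the \<open>i\<close>-th copy of \<open>H\<close>: it sends the
  distinguished vertex \<open>v\<close> to the vertex of \<open>F\<close> it is identified with and any other vertex \<open>w\<close> to
  the fresh vertex \<open>Inr (i, w)\<close>.
\<close>

definition pocket_map :: "'a list \<Rightarrow> 'b \<Rightarrow> nat \<Rightarrow> 'b \<Rightarrow> 'a + nat \<times> 'b" where
  "pocket_map us v i w = (if w = v then Inl (us ! i) else Inr (i, w))"

definition pocket_graph ::
  "('a, 'e) pre_digraph \<Rightarrow> 'a list \<Rightarrow> ('b, 'f) pre_digraph \<Rightarrow> 'b \<Rightarrow> ('a + nat \<times> 'b) pair_pre_digraph"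
where
  "pocket_graph F us H v =
     \<lparr> pverts = Inl ` verts F \<union> (\<Union>i<length us. pocket_map us v i ` verts H),
       parcs = map_prod Inl Inl ` arcs_ends F \<union>
         (\<Union>i<length us. map_prod (pocket_map us v i) (pocket_map us v i) ` arcs_ends H) \<rparr>"

lemma graph_pocket_graph:
  assumes "graph F" "graph H"
  shows "graph (with_proj (pocket_graph F us H v))"
proof -
  interpret F: graph F by fact
  interpret H: graph H by fact
  let ?G = "pocket_graph F us H v"
  have fin: "finite (arcs_ends F)" "finite (arcs_ends H)"
    by (simp_all add: arcs_ends_def)
  have sym_image: "sym (map_prod f f ` r)" if "sym r" for f :: "'x \<Rightarrow> 'y" and r
    using that by (force simp: sym_def)
  have "sym (arcs_ends F)" "sym (arcs_ends H)"
    using F.sym_arcs H.sym_arcs by (simp_all add: symmetric_def)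
  then have sym: "sym (parcs ?G)"
    by (auto simp: pocket_graph_def intro!: sym_Un sym_UNION sym_image)
  have inj: "a = b" if "pocket_map us v i a = pocket_map us v i b" for a b i
    using that by (auto simp: pocket_map_def split: if_splits)
  have noF: "(a, a) \<notin> arcs_ends F" and noH: "(b, b) \<notin> arcs_ends H" for a b
    using F.adj_not_same H.adj_not_same by blast+
  have "pair_graph ?G"
  proof unfold_locales
    show "symmetric (with_proj ?G)"
      using sym by (simp add: symmetric_def)
    show "fst e \<noteq> snd e" if "e \<in> parcs ?G" for e
      using that by (auto simp: pocket_graph_def noF noH dest!: inj)
    show "fst e \<in> pverts ?G" "snd e \<in> pverts ?G" if "e \<in> parcs ?G" for e
      using that unfolding pocket_graph_def by (fastforce dest: F.adj_in_verts H.adj_in_verts)+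
    show "finite (pverts ?G)" "finite (parcs ?G)"
      using fin by (simp_all add: pocket_graph_def)
  qed
  then show ?thesis
    by (rule pair_graph.pair_graphD_graph)
qed

end

theory Submission
  imports Defs
begin

text \<open>
  List the vertices of \<open>F\<close> first and then the copies of \<open>H\<^sub>1\<close> one after the other. The Schur
  complement with respect to the block \<open>x I - A(H\<^sub>1)\<close> of the last copy splits off a factor
  \<open>f(A(H\<^sub>1))\<close>. Since \<open>v\<close> is adjacent to all of \<open>H\<^sub>1\<close>, the correction subtracts the coronal from the
  diagonal entry of \<open>v\<^sub>k\<close> and changes nothing else. The formula follows by removing the pockets one
  by one.
\<close>

section \<open>Schur complement of an invertible lower right block\<close>

text \<open>Right multiplication by the block unitriangular matrix with lower left block
  \<open>- (D' * C)\<close> clears \<open>C\<close>, because \<open>D * D' * C = C\<close>. What is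
  left is block upper triangular, and the multiplier has determinant 1.\<close>

lemma det_schur_complement:
  fixes A B C D D' :: "'c :: idom mat"
  assumes A: "A \<in> carrier_mat p p" and B: "B \<in> carrier_mat p s" and C: "C \<in> carrier_mat s p"
    and D: "D \<in> carrier_mat s s" and D': "D' \<in> carrier_mat s s" and inv: "D * D' = 1\<^sub>m s"
  shows "det (four_block_mat A B C D) = det (A - B * D' * C) * det D"
proof -
  have DC: "D' * C \<in> carrier_mat s p"
    using D' C by simp
  have DDC: "D * (D' * C) = C"
    using C D D' by (simp add: inv flip: assoc_mult_mat[of _ s s _ s])
  have "four_block_mat A B C D * four_block_mat (1\<^sub>m p) (0\<^sub>m p s) (- (D' * C)) (1\<^sub>m s) =
      four_block_mat (A * 1\<^sub>m p + B * - (D' * C)) (A * 0\<^sub>m p s + B * 1\<^sub>m s)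
        (C * 1\<^sub>m p + D * - (D' * C)) (C * 0\<^sub>m p s + D * 1\<^sub>m s)"
    using DC by (intro mult_four_block_mat[OF A B C D, where ?nc1.0 = p and ?nc2.0 = s]) simp_all
  also have "A * 1\<^sub>m p + B * - (D' * C) = A - B * D' * C"
    using A B C D' DC by (simp add: minus_add_uminus_mat[of _ p p] assoc_mult_mat[of _ p s])
  also have "A * 0\<^sub>m p s + B * 1\<^sub>m s = B"
    using A B by simp
  also have "C * 1\<^sub>m p + D * - (D' * C) = 0\<^sub>m s p"
    using C D D' DC DDC by (simp add: add_uminus_minus_mat[of _ s p])
  also have "C * 0\<^sub>m p s + D * 1\<^sub>m s = D"
    using C D by simp
  finally have eq: "four_block_mat A B C D * four_block_mat (1\<^sub>m p) (0\<^sub>m p s) (- (D' * C)) (1\<^sub>m s) =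
      four_block_mat (A - B * D' * C) B (0\<^sub>m s p) D" .
  have "det (four_block_mat A B C D) *
      det (four_block_mat (1\<^sub>m p) (0\<^sub>m p s) (- (D' * C)) (1\<^sub>m s)) =
      det (four_block_mat (A - B * D' * C) B (0\<^sub>m s p) D)"
    using A D unfolding eq[symmetric] by (intro det_mult[symmetric, where n = "p + s"]) auto
  moreover have "det (four_block_mat (1\<^sub>m p) (0\<^sub>m p s) (- (D' * C)) (1\<^sub>m s)) = (1 :: 'c)"
    using DC by (subst det_four_block_mat_upper_right_zero[where n = p and m = s]) auto
  moreover have "det (four_block_mat (A - B * D' * C) B (0\<^sub>m s p) D) = det (A - B * D' * C) * det D"
    using A B C D D'
    by (intro det_four_block_mat_lower_left_zero[where n = p and m = s]) (auto intro!: minus_carrier_mat)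
  ultimately show ?thesis
    by simp
qed

section \<open>Matrices indexed by lists of labels\<close>

text \<open>Entries depend on labels, not on positions, so concatenating lists yields block matrices
  and reordering the vertices is just a permutation of the list.\<close>

definition list_mat :: "('i \<Rightarrow> 'j \<Rightarrow> 'c) \<Rightarrow> 'i list \<Rightarrow> 'j list \<Rightarrow> 'c mat" where
  "list_mat f xs ys = mat (length xs) (length ys) (\<lambda>(i, j). f (xs ! i) (ys ! j))"

lemma list_mat_carrier [simp]: "list_mat f xs ys \<in> carrier_mat (length xs) (length ys)"
  by (simp add: list_mat_def)

lemma list_mat_cong:
  "(\<And>x y. x \<in> set xs \<Longrightarrow> y \<in> set ys \<Longrightarrow> f x y = g x y) \<Longrightarrow> list_mat f xs ys = list_mat g xs ys"
  by (auto simp: list_mat_def intro!: cong_mat)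

lemma list_mat_map: "list_mat f (map p xs) (map q ys) = list_mat (\<lambda>x y. f (p x) (q y)) xs ys"
  by (auto simp: list_mat_def intro!: cong_mat)

lemma list_mat_append:
  "list_mat f (xs @ xs') (ys @ ys') =
     four_block_mat (list_mat f xs ys) (list_mat f xs ys') (list_mat f xs' ys) (list_mat f xs' ys')"
  by (rule eq_matI) (auto simp: list_mat_def nth_append)

text \<open>Rows and columns undergo the same permutation, so its sign enters twice and
  cancels.\<close>

lemma det_list_mat_permute:
  fixes f :: "'i \<Rightarrow> 'i \<Rightarrow> 'c :: comm_ring_1"
  assumes "mset xs = mset ys"
  shows "det (list_mat f xs xs) = det (list_mat f ys ys)"
proof -
  obtain p where p: "p permutes {..<length ys}" "permute_list p ys = xs"
    using mset_eq_permutation[OF assms] .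
  define n where "n = length ys"
  have len: "length xs = n"
    using p by (auto simp: n_def)
  have nth: "xs ! i = ys ! p i" if "i < n" for i
    using that p permute_list_nth[OF p(1)] by (auto simp: n_def)
  have perm: "p permutes {0..<n}"
    using p(1) by (simp add: n_def atLeast0LessThan)
  have less: "p i < n" if "i < n" for i
    using that permutes_in_image[OF perm, of i] by simp
  define A where "A = list_mat f ys ys"
  \<comment> \<open>\<open>B\<close> is the halfway matrix: its columns are already in the order
    \<open>xs\<close>, its rows still in the order \<open>ys\<close>.\<close>
  define B where "B = list_mat f ys xs"
  have carrier: "A \<in> carrier_mat n n" "B \<in> carrier_mat n n"
    by (simp_all add: A_def B_def list_mat_def len n_def)
  have "list_mat f xs xs = mat n n (\<lambda>(i, j). B $$ (p i, j))"
    by (rule eq_matI) (auto simp: list_mat_def B_def len nth less simp flip: n_def)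
  then have *: "det (list_mat f xs xs) = signof p * det B"
    using det_permute_rows[OF carrier(2) perm] by simp
  \<comment> \<open>Transposing turns the column permutation from \<open>A\<close> to
    \<open>B\<close> into a row permutation.\<close>
  have "transpose_mat B = mat n n (\<lambda>(i, j). transpose_mat A $$ (p i, j))"
    by (rule eq_matI) (auto simp: list_mat_def A_def B_def len nth less simp flip: n_def)
  then have "det (transpose_mat B) = signof p * det (transpose_mat A)"
    using det_permute_rows[OF _ perm, of "transpose_mat A"] carrier by simp
  then have "det B = signof p * det A"
    using carrier by (simp add: det_transpose)
  with * show ?thesis
    by (simp add: A_def sign_def)
qed

text \<open>The outer factors have rank at most one: with \<one> the all-ones vector,
  \<open>(a 1^T) D (1 b^T) = (1^T D 1) a b^T\<close>. When \<open>D\<close> inverts a characteristic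
  matrix, the scalar in the middle is the coronal.\<close>

lemma constant_rows_mult_constant_cols:
  fixes D :: "'c :: comm_ring_1 mat"
  assumes D: "D \<in> carrier_mat s s"
  shows "mat p s (\<lambda>(i, _). a i) * D * mat s q (\<lambda>(_, j). b j) =
    mat p q (\<lambda>(i, j). a i * (vec s (\<lambda>_. 1) \<bullet> (D *\<^sub>v vec s (\<lambda>_. 1))) * b j)"
proof (rule eq_matI)
  fix i j
  assume ij: "i < dim_row (mat p q (\<lambda>(i, j). a i * (vec s (\<lambda>_. 1) \<bullet> (D *\<^sub>v vec s (\<lambda>_. 1))) * b j))"
    "j < dim_col (mat p q (\<lambda>(i, j). a i * (vec s (\<lambda>_. 1) \<bullet> (D *\<^sub>v vec s (\<lambda>_. 1))) * b j))"
  have "(mat p s (\<lambda>(i, _). a i) * D * mat s q (\<lambda>(_, j). b j)) $$ (i, j) =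
      (mat p s (\<lambda>(i, _). a i) * (D * mat s q (\<lambda>(_, j). b j))) $$ (i, j)"
    using D by (subst assoc_mult_mat[of _ p s _ s _ q]) auto
  also have "\<dots> = a i * (\<Sum>r<s. (\<Sum>t<s. D $$ (r, t))) * b j"
    using D ij by (simp add: scalar_prod_def sum_distrib_left sum_distrib_right mult.assoc
      atLeast0LessThan)
  also have "(\<Sum>r<s. (\<Sum>t<s. D $$ (r, t))) = vec s (\<lambda>_. 1) \<bullet> (D *\<^sub>v vec s (\<lambda>_. 1))"
    using D by (simp add: scalar_prod_def atLeast0LessThan)
  finally show "(mat p s (\<lambda>(i, _). a i) * D * mat s q (\<lambda>(_, j). b j)) $$ (i, j) =
      mat p q (\<lambda>(i, j). a i * (vec s (\<lambda>_. 1) \<bullet> (D *\<^sub>v vec s (\<lambda>_. 1))) * b j) $$ (i, j)"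
    using ij by simp
qed (use D in auto)

section \<open>Removing the pockets one by one\<close>

text \<open>This is the pattern of \<open>x I - A(G)\<close>, with \<phi> for the block of F and
  \<beta> for each copy of H_1. The entries -1 encode that \<open>v\<close> is joined to all of H_1.
  Leaving \<phi> arbitrary lets it absorb the corrections from removed pockets.\<close>

fun pocket_entry ::
  "('a \<Rightarrow> 'a \<Rightarrow> 'c) \<Rightarrow> ('b \<Rightarrow> 'b \<Rightarrow> 'c) \<Rightarrow> 'a list \<Rightarrow> 'a + nat \<times> 'b \<Rightarrow> 'a + nat \<times> 'b \<Rightarrow> 'c :: comm_ring_1"
where
  "pocket_entry \<phi> \<beta> us (Inl a) (Inl b) = \<phi> a b"
| "pocket_entry \<phi> \<beta> us (Inl a) (Inr (j, w)) = (if a = us ! j then -1 else 0)"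
| "pocket_entry \<phi> \<beta> us (Inr (i, u)) (Inl b) = (if b = us ! i then -1 else 0)"
| "pocket_entry \<phi> \<beta> us (Inr (i, u)) (Inr (j, w)) = (if i = j then \<beta> u w else 0)"

definition pocket_list :: "'a list \<Rightarrow> 'b list \<Rightarrow> nat \<Rightarrow> ('a + nat \<times> 'b) list" where
  "pocket_list fs hs k = map Inl fs @ map Inr (List.product [0..<k] hs)"

lemma pocket_list_0 [simp]: "pocket_list fs hs 0 = map Inl fs"
  by (simp add: pocket_list_def)

lemma pocket_list_Suc:
  "pocket_list fs hs (Suc k) = pocket_list fs hs k @ map (\<lambda>h. Inr (k, h)) hs"
proof -
  \<comment> \<open>An arbitrary prefix makes list induction possible; the instance used is
    \<open>[0..<k]\<close>.\<close>
  have "List.product (xs @ [k]) hs = List.product xs hs @ map (Pair k) hs" for xs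
    by (induction xs) simp_all
  then show ?thesis
    by (simp add: pocket_list_def)
qed

lemma set_pocket_list: "set (pocket_list fs hs k) = Inl ` set fs \<union> Inr ` ({..<k} \<times> set hs)"
  by (auto simp: pocket_list_def)

lemma distinct_pocket_list: "distinct fs \<Longrightarrow> distinct hs \<Longrightarrow> distinct (pocket_list fs hs k)"
  by (auto simp: pocket_list_def distinct_map distinct_product)

text \<open>Induction on the number of pockets. Removing the last one changes \<phi>, hence the
  generalisation over \<phi>; the sum collects the changes.\<close>

lemma det_pocket_entry:
  fixes \<phi> :: "'a \<Rightarrow> 'a \<Rightarrow> 'c :: idom" and \<beta> :: "'b \<Rightarrow> 'b \<Rightarrow> 'c"
  assumes D: "D \<in> carrier_mat (length hs) (length hs)"
    and inv: "list_mat \<beta> hs hs * D = 1\<^sub>m (length hs)"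
  defines "\<gamma> \<equiv> vec (length hs) (\<lambda>_. 1) \<bullet> (D *\<^sub>v vec (length hs) (\<lambda>_. 1))"
  shows "det (list_mat (pocket_entry \<phi> \<beta> us) (pocket_list fs hs k) (pocket_list fs hs k)) =
    det (list_mat \<beta> hs hs) ^ k *
      det (list_mat (\<lambda>a b. \<phi> a b - (\<Sum>i<k. if a = us ! i \<and> b = us ! i then \<gamma> else 0)) fs fs)"
proof (induction k arbitrary: \<phi>)
  case 0
  then show ?case
    by (simp add: list_mat_map)
next
  case (Suc k)
  define s where "s = length hs"
  define L where "L = pocket_list fs hs k"
  define hs' where "hs' = map (\<lambda>h. Inr (k, h) :: 'a + nat \<times> 'b) hs"
  \<comment> \<open>All border columns of the last pocket agree with \<open>c\<close>, and so do its
    border rows: a vertex of an earlier copy is not adjacent to this one, so only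
    \<open>us ! k\<close> contributes.\<close>
  define c :: "'a + nat \<times> 'b \<Rightarrow> 'c" where "c x = (if x = Inl (us ! k) then -1 else 0)" for x
  define \<phi>' where "\<phi>' a b = \<phi> a b - (if a = us ! k \<and> b = us ! k then \<gamma> else 0)" for a b
  let ?f = "pocket_entry \<phi> \<beta> us" and ?f' = "pocket_entry \<phi>' \<beta> us"
  have len: "length hs' = s"
    by (simp add: hs'_def s_def)
  have c: "?f x (Inr (k, h)) = c x" "?f (Inr (k, h)) x = c x" if "x \<in> set L" for x h
    using that by (auto simp: c_def L_def set_pocket_list split: if_splits)
  have c_nth: "?f (L ! i) (Inr (k, h)) = c (L ! i)" "?f (Inr (k, h)) (L ! i) = c (L ! i)"
    if "i < length L" for i h
    using that by (simp_all add: c)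
  have right: "list_mat ?f L hs' = mat (length L) s (\<lambda>(i, _). c (L ! i))"
    and left: "list_mat ?f hs' L = mat s (length L) (\<lambda>(_, j). c (L ! j))"
    by (auto simp: list_mat_def hs'_def s_def c_nth intro!: cong_mat)
  have block: "list_mat ?f hs' hs' = list_mat \<beta> hs hs"
    by (simp add: hs'_def list_mat_map)
  \<comment> \<open>Since \<open>c\<close> vanishes on every \<open>Inr\<close>, only the entry at
    \<open>us ! k\<close> changes, by \<open>(-1) * \<gamma> * (-1)\<close>.\<close>
  have entry: "?f x y - c x * \<gamma> * c y = ?f' x y" for x y
    by (cases "(\<phi>, \<beta>, us, x, y)" rule: pocket_entry.cases) (auto simp: c_def \<phi>'_def)
  have "list_mat ?f L L - list_mat ?f L hs' * D * list_mat ?f hs' L = list_mat ?f' L L"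
    unfolding right left constant_rows_mult_constant_cols[OF D[folded s_def]] \<gamma>_def[folded s_def, symmetric]
    by (rule eq_matI) (simp_all add: list_mat_def entry)
  then have "det (list_mat ?f (L @ hs') (L @ hs')) = det (list_mat ?f' L L) * det (list_mat \<beta> hs hs)"
    unfolding list_mat_append block
    using D inv list_mat_carrier[of \<beta> hs hs]
    by (subst det_schur_complement[where p = "length L" and s = s and D' = D])
      (simp_all add: right left flip: s_def)
  also have "det (list_mat ?f' L L) = det (list_mat \<beta> hs hs) ^ k *
      det (list_mat (\<lambda>a b. \<phi>' a b - (\<Sum>i<k. if a = us ! i \<and> b = us ! i then \<gamma> else 0)) fs fs)"
    unfolding L_def by (rule Suc.IH)
  finally show ?case
    by (simp add: pocket_list_Suc L_def hs'_def \<phi>'_def algebra_simps)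
qed

section \<open>Characteristic matrices and adjacency in the graph with pockets\<close>

lemma to_fract_const_1 [simp]: "to_fract [:1:] = 1"
  by (simp flip: one_pCons)

lemma ratfun_char_matrix_eq_list_mat:
  assumes "distinct us"
  shows "ratfun_x \<cdot>\<^sub>m 1\<^sub>m (length us) - ratfun_mat (adjacency_mat G us) =
    list_mat (\<lambda>x y. (if x = y then ratfun_x else 0) - (if x \<rightarrow>\<^bsub>G\<^esub> y then 1 else 0)) us us"
  using assms
  by (intro eq_matI)
    (auto simp: list_mat_def ratfun_mat_def adjacency_mat_def nth_eq_iff_index_eq)

text \<open>Without parallel arcs, heads are injective on the arcs leaving \<open>v\<close>; without
  loops, they avoid \<open>v\<close>. Equal cardinalities then force the heads to exhaust the other
  vertices.\<close>

lemma (in graph) dominates_all_if_out_degree: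
  assumes "v \<in> verts G" "out_degree G v = card (verts G) - 1" "w \<in> verts G" "w \<noteq> v"
  shows "v \<rightarrow>\<^bsub>G\<^esub> w"
proof -
  have inj: "inj_on (head G) (out_arcs G v)"
    by (rule inj_onI) (auto intro!: no_multi_arcs simp: arc_to_ends_def)
  have sub: "head G ` out_arcs G v \<subseteq> verts G - {v}"
    using no_loops by auto
  have "head G ` out_arcs G v = verts G - {v}"
    using assms(1,2) card_image[OF inj] by (intro card_subset_eq sub) (auto simp: out_degree_def)
  moreover have "w \<in> verts G - {v}"
    using assms by simp
  ultimately obtain e where "e \<in> out_arcs G v" "head G e = w"
    by (metis imageE)
  then show ?thesis
    by (auto simp: arcs_ends_def arc_to_ends_def intro!: image_eqI[of _ _ e])
qed

lemma pocket_graph_dominates_iff: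
  "x \<rightarrow>\<^bsub>with_proj (pocket_graph F us H v)\<^esub> y \<longleftrightarrow>
    (\<exists>a b. x = Inl a \<and> y = Inl b \<and> a \<rightarrow>\<^bsub>F\<^esub> b) \<or>
    (\<exists>i<length us. \<exists>u w. x = pocket_map us v i u \<and> y = pocket_map us v i w \<and> u \<rightarrow>\<^bsub>H\<^esub> w)"
proof -
  have "arcs_ends (with_proj P) = parcs P" for P :: "'x pair_pre_digraph"
    by (auto simp: arcs_ends_def arc_to_ends_def)
  then show ?thesis
    by (fastforce simp: pocket_graph_def)
qed

text \<open>Within one copy only \<open>v\<close> is sent to an \<open>Inl\<close>, so an arc of a
  copy between two vertices of F would come from a loop at \<open>v\<close>.\<close>

lemma pocket_graph_dominates_Inl_Inl:
  fixes F :: "('a, 'e) pre_digraph" and H :: "('b, 'f) pre_digraph"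
  assumes "graph H"
  shows "Inl a \<rightarrow>\<^bsub>with_proj (pocket_graph F us H v)\<^esub> Inl b \<longleftrightarrow> a \<rightarrow>\<^bsub>F\<^esub> b"
proof -
  interpret H: graph H by fact
  have "\<not> v \<rightarrow>\<^bsub>H\<^esub> v"
    using H.adj_not_same by blast
  then show ?thesis
    unfolding pocket_graph_dominates_iff by (auto simp: pocket_map_def split: if_splits)
qed

lemma pocket_graph_dominates_Inr:
  fixes F :: "('a, 'e) pre_digraph" and H :: "('b, 'f) pre_digraph"
  assumes "u \<noteq> v" "i < length us"
  shows "Inl a \<rightarrow>\<^bsub>with_proj (pocket_graph F us H v)\<^esub> Inr (i, u) \<longleftrightarrow> a = us ! i \<and> v \<rightarrow>\<^bsub>H\<^esub> u"
    and "Inr (i, u) \<rightarrow>\<^bsub>with_proj (pocket_graph F us H v)\<^esub> Inl a \<longleftrightarrow> a = us ! i \<and> u \<rightarrow>\<^bsub>H\<^esub> v"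
    and "w \<noteq> v \<Longrightarrow>
      Inr (i, u) \<rightarrow>\<^bsub>with_proj (pocket_graph F us H v)\<^esub> Inr (j, w) \<longleftrightarrow> i = j \<and> u \<rightarrow>\<^bsub>H\<^esub> w"
  unfolding pocket_graph_dominates_iff using assms by (auto simp: pocket_map_def split: if_splits)

lemma del_vert_dominates_iff:
  "x \<rightarrow>\<^bsub>pre_digraph.del_vert G v\<^esub> y \<longleftrightarrow> x \<rightarrow>\<^bsub>G\<^esub> y \<and> x \<noteq> v \<and> y \<noteq> v"
  by (auto simp: arcs_ends_def arc_to_ends_def pre_digraph.del_vert_def)

lemma char_poly_adjacency_mat:
  assumes "distinct us"
  shows "to_fract (char_poly (adjacency_mat G us :: 'c :: field mat)) =
    det (list_mat (\<lambda>x y. (if x = y then ratfun_x else 0 :: 'c poly fract) -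
      (if x \<rightarrow>\<^bsub>G\<^esub> y then 1 else 0)) us us)"
proof -
  have "(adjacency_mat G us :: 'c mat) \<in> carrier_mat (length us) (length us)"
    by (simp add: adjacency_mat_def)
  then show ?thesis
    unfolding ratfun_char_matrix_eq_list_mat[OF assms, symmetric] by (rule det_ratfun_mat[symmetric])
qed

section \<open>The characteristic polynomial of the graph with pockets\<close>

theorem proposition3p1:
  fixes F :: "('a, 'e) pre_digraph" and H :: "('b, 'f) pre_digraph"
    and V :: "'a set" and v :: 'b and n m k :: nat
    and fs :: "'a list" and hs :: "'b list" and gs :: "('a + nat \<times> 'b) list"
  assumes F: "graph F" "card (verts F) = n" "n \<ge> 1"
    and V: "V \<subseteq> verts F" "card V = k"
    and H: "graph H" "card (verts H) = m" "m \<ge> 2" "v \<in> verts H" "out_degree H v = m - 1"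
  defines "H1 \<equiv> pre_digraph.del_vert H v"
    and "G \<equiv> with_proj (pocket_graph F (take k fs) H v)"
  assumes fs: "distinct fs" "set fs = verts F" "set (take k fs) = V"
    and hs: "distinct hs" "set hs = verts H1"
    and gs: "distinct gs" "set gs = verts G"
  defines "M \<equiv> ratfun_mat (adjacency_mat F fs) +
      coronal (adjacency_mat H1 hs :: real mat) \<cdot>\<^sub>m
        four_block_mat (1\<^sub>m k) (0\<^sub>m k (n - k)) (0\<^sub>m (n - k) k) (0\<^sub>m (n - k) (n - k))"
  shows "to_fract (char_poly (adjacency_mat G gs :: real mat)) =
      to_fract (char_poly (adjacency_mat H1 hs)) ^ k * det (ratfun_x \<cdot>\<^sub>m 1\<^sub>m n - M)"
proof -
  interpret F: graph F by fact
  interpret H: graph H by fact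
  let ?X = "ratfun_x :: real poly fract"
  define us where "us = take k fs"
  define s where "s = length hs"
  define N where "N = (adjacency_mat H1 hs :: real mat)"
  \<comment> \<open>\<phi>, \<beta> and \<psi> are the entries of \<open>x I - A\<close> for F, H_1
    and G, respectively.\<close>
  define \<phi> where "\<phi> x y = (if x = y then ?X else 0) - (if x \<rightarrow>\<^bsub>F\<^esub> y then 1 else 0)" for x y
  define \<beta> where "\<beta> x y = (if x = y then ?X else 0) - (if x \<rightarrow>\<^bsub>H1\<^esub> y then 1 else 0)" for x y
  define \<psi> where "\<psi> x y = (if x = y then ?X else 0) - (if x \<rightarrow>\<^bsub>G\<^esub> y then 1 else 0)" for x y
  define L where "L = pocket_list fs hs k"
  have len_fs: "length fs = n"
    using F(2) fs(1,2) distinct_card by metis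
  have k: "k \<le> n"
    using V F(2) card_mono[OF F.finite_verts] by metis
  then have len_us: "length us = k"
    by (simp add: us_def len_fs)
  have us_nth: "us ! i = fs ! i" if "i < k" for i
    using that by (simp add: us_def)
  have us_sub: "us ! i \<in> verts F" if "i < k" for i
    using that k len_fs fs(2) by (metis us_nth nth_mem less_le_trans)
  have set_hs: "set hs = verts H - {v}"
    by (simp add: hs(2) H1_def pre_digraph.del_vert_def)
  \<comment> \<open>The degree hypothesis enters here; symmetry supplies the reverse arcs.\<close>
  have v_dom: "v \<rightarrow>\<^bsub>H\<^esub> w" "w \<rightarrow>\<^bsub>H\<^esub> v" if "w \<in> set hs" for w
    using that H.dominates_all_if_out_degree[of v w] H set_hs arcs_ends_symmetric[OF H.sym_arcs] by auto

  have not_v: "w \<noteq> v" if "w \<in> set hs" for w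
    using that set_hs by simp
  have H1_dom: "u \<rightarrow>\<^bsub>H1\<^esub> w \<longleftrightarrow> u \<rightarrow>\<^bsub>H\<^esub> w" if "u \<in> set hs" "w \<in> set hs" for u w
    using that by (simp add: H1_def del_vert_dominates_iff not_v)
  have G: "G = with_proj (pocket_graph F us H v)"
    by (simp add: G_def us_def)
  have G_dom: "Inl a \<rightarrow>\<^bsub>G\<^esub> Inl b \<longleftrightarrow> a \<rightarrow>\<^bsub>F\<^esub> b" for a b
    unfolding G by (rule pocket_graph_dominates_Inl_Inl[OF H(1)])
  have G_dom':
    "Inl a \<rightarrow>\<^bsub>G\<^esub> Inr (i, u) \<longleftrightarrow> a = us ! i \<and> v \<rightarrow>\<^bsub>H\<^esub> u"
    "Inr (i, u) \<rightarrow>\<^bsub>G\<^esub> Inl a \<longleftrightarrow> a = us ! i \<and> u \<rightarrow>\<^bsub>H\<^esub> v"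
    "w \<in> set hs \<Longrightarrow> Inr (i, u) \<rightarrow>\<^bsub>G\<^esub> Inr (j, w) \<longleftrightarrow> i = j \<and> u \<rightarrow>\<^bsub>H\<^esub> w"
    if "i < k" "u \<in> set hs" for i j u w a
    unfolding G using that by (intro pocket_graph_dominates_Inr; simp add: not_v len_us)+
  \<comment> \<open>The vertex \<open>v\<close> of each copy lands on a vertex of F, so a copy adds
    only the vertices of H_1.\<close>
  have G_verts: "verts G = Inl ` verts F \<union> Inr ` ({..<k} \<times> set hs)"
    using us_sub H(4) set_hs
    by (auto simp: G_def pocket_graph_def pocket_map_def len_us simp flip: us_def)
  \<comment> \<open>Both lists enumerate the vertices of G without repetition, so the given ordering
    may be exchanged for the one by pockets.\<close>
  have "mset gs = mset L"
    using gs fs hs G_verts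
    by (simp add: L_def set_eq_iff_mset_eq_distinct[symmetric] set_pocket_list distinct_pocket_list)
  then have "to_fract (char_poly (adjacency_mat G gs :: real mat)) = det (list_mat \<psi> L L)"
    unfolding char_poly_adjacency_mat[OF gs(1)] \<psi>_def[abs_def] by (rule det_list_mat_permute)
  also have "list_mat \<psi> L L = list_mat (pocket_entry \<phi> \<beta> us) L L"
  proof (rule list_mat_cong)
    fix x y
    assume "x \<in> set L" "y \<in> set L"
    then show "\<psi> x y = pocket_entry \<phi> \<beta> us x y"
      by (cases "(\<phi>, \<beta>, us, x, y)" rule: pocket_entry.cases)
        (auto simp: L_def set_pocket_list \<psi>_def \<phi>_def \<beta>_def G_dom G_dom' H1_dom v_dom)
  qed
  finally have lhs: "to_fract (char_poly (adjacency_mat G gs :: real mat)) =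
    det (list_mat (pocket_entry \<phi> \<beta> us) L L)" .

  have N: "N \<in> carrier_mat s s"
    by (simp add: N_def adjacency_mat_def s_def)
  have B: "?X \<cdot>\<^sub>m 1\<^sub>m s - ratfun_mat N = list_mat \<beta> hs hs"
    using ratfun_char_matrix_eq_list_mat[OF hs(1), of H1] by (simp add: N_def s_def \<beta>_def[abs_def])
  \<comment> \<open>Taking \<open>D\<close> from \<open>mat_inverse\<close> makes it the very
    inverse in the definition of the coronal.\<close>
  obtain D where D: "mat_inverse (?X \<cdot>\<^sub>m 1\<^sub>m s - ratfun_mat N) = Some D" "D \<in> carrier_mat s s"
    "list_mat \<beta> hs hs * D = 1\<^sub>m s"
    using mat_inverse_ratfun_mat[OF N] unfolding B by auto
  have \<gamma>: "coronal N = vec s (\<lambda>_. 1) \<bullet> (D *\<^sub>v vec s (\<lambda>_. 1))"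
    using N D(1) by (simp add: coronal_def Let_def)
  have "det (list_mat (pocket_entry \<phi> \<beta> us) L L) = det (list_mat \<beta> hs hs) ^ k *
      det (list_mat (\<lambda>a b. \<phi> a b - (\<Sum>i<k. if a = us ! i \<and> b = us ! i then coronal N else 0)) fs fs)"
    unfolding L_def \<gamma> s_def using D(2,3) by (intro det_pocket_entry) (simp_all add: s_def)
  also have "det (list_mat \<beta> hs hs) = to_fract (char_poly N)"
    by (simp add: N_def char_poly_adjacency_mat[OF hs(1)] \<beta>_def[abs_def])
  also have "list_mat (\<lambda>a b. \<phi> a b - (\<Sum>i<k. if a = us ! i \<and> b = us ! i then coronal N else 0)) fs fs =
      ?X \<cdot>\<^sub>m 1\<^sub>m n - M" (is "?L = ?R")
  proof (rule eq_matI)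
    fix i j
    assume "i < dim_row ?R" "j < dim_col ?R"
    then have ij: "i < n" "j < n"
      using k by (simp_all add: M_def)
    have eq_iff: "fs ! p = fs ! q \<longleftrightarrow> p = q" if "p < n" "q < n" for p q
      using that fs(1) by (simp add: nth_eq_iff_index_eq len_fs)
    \<comment> \<open>As \<open>fs\<close> is distinct and begins with \<open>us\<close>, at most
      the summand \<open>l = i\<close> survives, and only on the diagonal with \<open>i < k\<close>:
      this is the block I_k.\<close>
    have "(\<Sum>l<k. if fs ! i = us ! l \<and> fs ! j = us ! l then coronal N else 0) =
        (\<Sum>l<k. if l = i then (if i = j then coronal N else 0) else 0)"
      using ij k by (intro sum.cong) (auto simp: us_nth eq_iff)
    also have "\<dots> = (if i = j \<and> i < k then coronal N else 0)"
      by simp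
    finally show "?L $$ (i, j) = ?R $$ (i, j)"
      using ij k by (auto simp: list_mat_def len_fs M_def \<phi>_def eq_iff ratfun_mat_def
        adjacency_mat_def N_def)
  qed (use k in \<open>simp_all add: list_mat_def len_fs M_def\<close>)
  finally show ?thesis
    unfolding lhs N_def .
qed

end
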